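(* Let $\sigma\in\mathcal S_{0,\infty}$ be given and let the growth condition (defined in the context) hold for $\sigma$. The following are equivalent: (i) the impulsive system is strongly GES: there exist $M\ge1$, $\alpha>0$, $\rho\in(0,1)$ such that $\|U_\sigma(t,s)\|\le M\rho^{\kappa_\sigma(t,s)}e^{-\alpha(t-s)}$ for all $t\ge s\ge0$; (ii) there exist constants $p\ge1$, $c\ge1$, $\eta>0$, $\mu\in(0,1)$ and a functional $V:\mathbb R_{\ge0}\times X\to\mathbb R_{\ge0}$, Lipschitz on bounded subsets of $X$ uniformly in $t$ and piecewise right-continuous in $t$ (see context), satisfying $$\|x\|^p\le V(t,x)\le c\|x\|^p,\qquad \underline D^+V(t,x)\le-\eta V(t,x),\qquad V(t_k,Jx)\le\mu V(t_k^-,x)$$ for all $t\ge0$, $x\in X$ and all $t_k\in\mathbb T_\sigma$. Moreover, when (i) holds with constants $M\ge1$, $\alpha>0$, $\rho\in(0,1)$, an explicit functional witnessing (ii) is $$V(t,x):=\sup_{\tau\ge t}e^{\eta(\tau-t)}\nu^{\kappa_\sigma(\tau,t)}\|U_\sigma(\tau,t)x\|,\qquad t\ge0,\ x\in X,$$ for any choice of $\eta\in(0,\alpha)$ and $\nu\in(1,1/\rho)$; this $V$ satisfies the conditions in (ii) with $p=1$, $c=M$, the same $\eta$, and $\mu=1/\nu\in(0,1)$.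
   Context: Setting. $X$ is a Banach space with norm $\|\cdot\|$; $A:D(A)\subset X\to X$ generates a strongly continuous ($C_0$) semigroup $(S(t))_{t\ge0}$ on $X$; $J\in L(X)$ is bounded, $J\neq0$, $JD(A)\subset D(A)$. $\mathcal S_{0,\infty}$ is the set of sequences $\sigma=\{t_k\}_{k\ge1}$ with, setting $t_0:=0$, $t_{k+1}>t_k$ for all $k\ge0$ and $t_k\to\infty$; $\mathbb T_\sigma:=\{t_k:k\ge1\}$. The impulsive system is $\dot x(t)=Ax(t)$ for $t\notin\mathbb T_\sigma$, $x(t)=Jx(t^-)$ for $t\in\mathbb T_\sigma$. Its propagator $U_\sigma(t,s)$, $t\ge s\ge0$, is: $U_\sigma(t,s)=S(t-s)$ if $(s,t]\cap\mathbb T_\sigma=\varnothing$; otherwise, if $t_l<\dots<t_m$ are the impulse times in $(s,t]$, $U_\sigma(t,s)=S(t-t_m)JS(t_m-t_{m-1})J\cdots JS(t_l-s)$. $\kappa_\sigma(t,s):=\#(\mathbb T_\sigma\cap(s,t])$. Growth condition for $\sigma$: there exist a piecewise continuous $g:\mathbb R_{\ge0}\to\mathbb R_{>0}$ bounded below by some $c_0>0$, and $\mu_0>1$, such that $\|U_\sigma(t,s)x\|\le g(t-s)\mu_0^{\kappa_\sigma(t,s)}\|x\|$ for all $t\ge s\ge0$, $x\in X$, and $G:=\sup_{0\le\tau<\bar T}g(\tau)<\infty$, where $\bar T:=\sup_{k\ge0}(t_{k+1}-t_k)\in(0,\infty]$. Functionals. $V$ is Lipschitz on bounded subsets of $X$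 uniformly in $t$ if for every $r>0$ there is $L_r>0$ with $|V(t,x)-V(t,y)|\le L_r\|x-y\|$ for all $\|x\|<r$, $\|y\|<r$, $t\ge0$. Piecewise right-continuous in $t$ means: for each $x$, $t\mapsto V(t,x)$ is continuous on each $[t_k,t_{k+1})$, $k\ge0$, and has left limits $V(t_k^-,x):=\lim_{t\uparrow t_k}V(t,x)$ at impulse times. The lower right-hand Dini derivative along the flow is $$\underline D^+V(t,x):=\liminf_{h\downarrow0}\frac{V(t+h,S(h)x)-V(t,x)}{h}.$$ *)

theory Defs
  imports "HOL-Analysis.Analysis"
begin

definition C0_semigroup :: "(real \<Rightarrow> 'a::real_normed_vector \<Rightarrow>\<^sub>L 'a) \<Rightarrow> bool" where
  "C0_semigroup S \<longleftrightarrow>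
     S 0 = id_blinfun \<and>
     (\<forall>t\<ge>0. \<forall>s\<ge>0. S (t + s) = S t o\<^sub>L S s) \<and>
     (\<forall>x. ((\<lambda>h. S h x) \<longlongrightarrow> x) (at_right 0))"

definition generates_C0_semigroup ::
    "'a::real_normed_vector set \<Rightarrow> ('a \<Rightarrow> 'a) \<Rightarrow> (real \<Rightarrow> 'a \<Rightarrow>\<^sub>L 'a) \<Rightarrow> bool" where
  "generates_C0_semigroup D A S \<longleftrightarrow>
     C0_semigroup S \<and>
     D = {x. \<exists>y. ((\<lambda>h. (S h x - x) /\<^sub>R h) \<longlongrightarrow> y) (at_right 0)} \<and>
     (\<forall>x\<in>D. ((\<lambda>h. (S h x - x) /\<^sub>R h) \<longlongrightarrow> A x) (at_right 0))"

text \<open>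
  A sequence \<open>{t_k}\<close>, \<open>k \<ge> 1\<close>, is encoded as \<open>\<sigma> :: nat \<Rightarrow> real\<close> with \<open>\<sigma> k = t_k\<close>; the
  convention \<open>t_0 = 0\<close> is part of the encoding, but \<open>t_0\<close> is not an impulse time.
\<close>

definition impulse_sequences :: "(nat \<Rightarrow> real) set" where
  "impulse_sequences =
     {\<sigma>. \<sigma> 0 = 0 \<and> (\<forall>k. \<sigma> k < \<sigma> (Suc k)) \<and> filterlim \<sigma> at_top sequentially}"

definition impulse_times :: "(nat \<Rightarrow> real) \<Rightarrow> real set" where
  "impulse_times \<sigma> = \<sigma> ` {1..}"

definition impulse_count :: "(nat \<Rightarrow> real) \<Rightarrow> real \<Rightarrow> real \<Rightarrow> nat" where
  "impulse_count \<sigma> t s = card (impulse_times \<sigma> \<inter> {s<..t})"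

text \<open>
  In \<open>flow_along S J ts t s\<close> the list \<open>ts\<close> holds, in increasing order, the impulse times in
  \<open>(s, t]\<close>.
\<close>

primrec flow_along ::
    "(real \<Rightarrow> 'a::real_normed_vector \<Rightarrow>\<^sub>L 'a) \<Rightarrow> ('a \<Rightarrow>\<^sub>L 'a) \<Rightarrow> real list \<Rightarrow> real \<Rightarrow> real \<Rightarrow> 'a \<Rightarrow>\<^sub>L 'a"
  where
  "flow_along S J [] t s = S (t - s)"
| "flow_along S J (r # rs) t s = flow_along S J rs t r o\<^sub>L J o\<^sub>L S (r - s)"

definition propagator ::
    "(real \<Rightarrow> 'a::real_normed_vector \<Rightarrow>\<^sub>L 'a) \<Rightarrow> ('a \<Rightarrow>\<^sub>L 'a) \<Rightarrow> (nat \<Rightarrow> real) \<Rightarrow> real \<Rightarrow> real \<Rightarrow> 'a \<Rightarrow>\<^sub>L 'a"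
  where
  "propagator S J \<sigma> t s =
     flow_along S J (sorted_list_of_set (impulse_times \<sigma> \<inter> {s<..t})) t s"

text \<open>
  Piecewise continuity on the half-line: finitely many discontinuities in every bounded interval,
  all of them with finite one-sided limits.
\<close>

definition piecewise_continuous_nonneg :: "(real \<Rightarrow> real) \<Rightarrow> bool" where
  "piecewise_continuous_nonneg g \<longleftrightarrow>
     (\<exists>D. (\<forall>b. finite (D \<inter> {0..b})) \<and> continuous_on ({0..} - D) g) \<and>
     (\<forall>\<tau>\<ge>0. \<exists>l. (g \<longlongrightarrow> l) (at_right \<tau>)) \<and>
     (\<forall>\<tau>>0. \<exists>l. (g \<longlongrightarrow> l) (at_left \<tau>))"

definition max_dwell :: "(nat \<Rightarrow> real) \<Rightarrow> ereal" where
  "max_dwell \<sigma> = (SUP k. ereal (\<sigma> (Suc k) - \<sigma> k))"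

definition growth_condition ::
    "(real \<Rightarrow> 'a::real_normed_vector \<Rightarrow>\<^sub>L 'a) \<Rightarrow> ('a \<Rightarrow>\<^sub>L 'a) \<Rightarrow> (nat \<Rightarrow> real) \<Rightarrow> bool" where
  "growth_condition S J \<sigma> \<longleftrightarrow>
     (\<exists>g \<mu>\<^sub>0. piecewise_continuous_nonneg g \<and>
        (\<exists>c\<^sub>0>0. \<forall>\<tau>\<ge>0. c\<^sub>0 \<le> g \<tau>) \<and>
        \<mu>\<^sub>0 > 1 \<and>
        (\<forall>s\<ge>0. \<forall>t\<ge>s. \<forall>x.
           norm (propagator S J \<sigma> t s x) \<le> g (t - s) * \<mu>\<^sub>0 ^ impulse_count \<sigma> t s * norm x) \<and>
        (SUP \<tau>\<in>{\<tau>. 0 \<le> \<tau> \<and> ereal \<tau> < max_dwell \<sigma>}. ereal (g \<tau>)) < \<infinity>)"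

definition GES_estimate ::
    "(real \<Rightarrow> 'a::real_normed_vector \<Rightarrow>\<^sub>L 'a) \<Rightarrow> ('a \<Rightarrow>\<^sub>L 'a) \<Rightarrow> (nat \<Rightarrow> real) \<Rightarrow>
     real \<Rightarrow> real \<Rightarrow> real \<Rightarrow> bool" where
  "GES_estimate S J \<sigma> M \<alpha> \<rho> \<longleftrightarrow>
     M \<ge> 1 \<and> \<alpha> > 0 \<and> 0 < \<rho> \<and> \<rho> < 1 \<and>
     (\<forall>s\<ge>0. \<forall>t\<ge>s.
        norm (propagator S J \<sigma> t s) \<le> M * \<rho> ^ impulse_count \<sigma> t s * exp (- \<alpha> * (t - s)))"

definition strongly_GES ::
    "(real \<Rightarrow> 'a::real_normed_vector \<Rightarrow>\<^sub>L 'a) \<Rightarrow> ('a \<Rightarrow>\<^sub>L 'a) \<Rightarrow> (nat \<Rightarrow> real) \<Rightarrow> bool" where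
  "strongly_GES S J \<sigma> \<longleftrightarrow> (\<exists>M \<alpha> \<rho>. GES_estimate S J \<sigma> M \<alpha> \<rho>)"

definition lipschitz_on_bounded_unif :: "(real \<Rightarrow> 'a::real_normed_vector \<Rightarrow> real) \<Rightarrow> bool" where
  "lipschitz_on_bounded_unif V \<longleftrightarrow>
     (\<forall>r>0. \<exists>L>0. \<forall>t\<ge>0. \<forall>x y.
        norm x < r \<longrightarrow> norm y < r \<longrightarrow> \<bar>V t x - V t y\<bar> \<le> L * norm (x - y))"

definition piecewise_right_continuous ::
    "(nat \<Rightarrow> real) \<Rightarrow> (real \<Rightarrow> 'a \<Rightarrow> real) \<Rightarrow> bool" where
  "piecewise_right_continuous \<sigma> V \<longleftrightarrow>
     (\<forall>x. (\<forall>k. continuous_on {\<sigma> k..<\<sigma> (Suc k)} (\<lambda>t. V t x)) \<and>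
          (\<forall>k\<ge>1. \<exists>l. ((\<lambda>t. V t x) \<longlongrightarrow> l) (at_left (\<sigma> k))))"

text \<open>The lower Dini derivative may take the value \<open>-\<infinity>\<close>, hence the type \<open>ereal\<close>.\<close>

definition lower_Dini ::
    "(real \<Rightarrow> 'a::real_normed_vector \<Rightarrow>\<^sub>L 'a) \<Rightarrow> (real \<Rightarrow> 'a \<Rightarrow> real) \<Rightarrow> real \<Rightarrow> 'a \<Rightarrow> ereal" where
  "lower_Dini S V t x = Liminf (at_right 0) (\<lambda>h. ereal ((V (t + h) (S h x) - V t x) / h))"

definition lyapunov_functional ::
    "(real \<Rightarrow> 'a::real_normed_vector \<Rightarrow>\<^sub>L 'a) \<Rightarrow> ('a \<Rightarrow>\<^sub>L 'a) \<Rightarrow> (nat \<Rightarrow> real) \<Rightarrow>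
     real \<Rightarrow> real \<Rightarrow> real \<Rightarrow> real \<Rightarrow> (real \<Rightarrow> 'a \<Rightarrow> real) \<Rightarrow> bool" where
  "lyapunov_functional S J \<sigma> p c \<eta> \<mu> V \<longleftrightarrow>
     p \<ge> 1 \<and> c \<ge> 1 \<and> \<eta> > 0 \<and> 0 < \<mu> \<and> \<mu> < 1 \<and>
     (\<forall>t\<ge>0. \<forall>x. V t x \<ge> 0) \<and>
     lipschitz_on_bounded_unif V \<and>
     piecewise_right_continuous \<sigma> V \<and>
     (\<forall>t\<ge>0. \<forall>x. norm x powr p \<le> V t x \<and> V t x \<le> c * norm x powr p) \<and>
     (\<forall>t\<ge>0. \<forall>x. lower_Dini S V t x \<le> ereal (- \<eta> * V t x)) \<and>
     (\<forall>t\<^sub>k\<in>impulse_times \<sigma>. \<forall>x. V t\<^sub>k (J x) \<le> \<mu> * Lim (at_left t\<^sub>k) (\<lambda>t. V t x))"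

definition explicit_weight ::
    "(real \<Rightarrow> 'a::real_normed_vector \<Rightarrow>\<^sub>L 'a) \<Rightarrow> ('a \<Rightarrow>\<^sub>L 'a) \<Rightarrow> (nat \<Rightarrow> real) \<Rightarrow>
     real \<Rightarrow> real \<Rightarrow> real \<Rightarrow> 'a \<Rightarrow> real \<Rightarrow> real" where
  "explicit_weight S J \<sigma> \<eta> \<nu> t x \<tau> =
     exp (\<eta> * (\<tau> - t)) * \<nu> ^ impulse_count \<sigma> \<tau> t * norm (propagator S J \<sigma> \<tau> t x)"

text \<open>
  The supremum is taken in \<open>real\<close>, so it is meaningful only where the weights are bounded above.
\<close>

definition explicit_functional ::
    "(real \<Rightarrow> 'a::real_normed_vector \<Rightarrow>\<^sub>L 'a) \<Rightarrow> ('a \<Rightarrow>\<^sub>L 'a) \<Rightarrow> (nat \<Rightarrow> real) \<Rightarrow>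
     real \<Rightarrow> real \<Rightarrow> real \<Rightarrow> 'a \<Rightarrow> real" where
  "explicit_functional S J \<sigma> \<eta> \<nu> t x = (SUP \<tau>\<in>{t..}. explicit_weight S J \<sigma> \<eta> \<nu> t x \<tau>)"

end

theory Submission
  imports Defs
begin

text \<open>
  Both implications rest on the decomposition of the time axis into dwell intervals
  \<open>[\<sigma> k, \<sigma> (Suc k))\<close>. There the propagator is the semigroup, across the right end it picks up one
  factor \<open>J\<close>, and \<open>propagator_compose\<close> together with \<open>impulse_count_split\<close> glues the pieces.

  A Lyapunov functional yields stability because, along a trajectory inside one dwell interval, it is
  a continuous function of time whose lower Dini derivative is at most \<open>- \<eta>\<close> times its value, so it
  decays like \<open>exp (- \<eta> t)\<close> (\<open>lower_Dini_decay\<close>). Continuity of \<open>V t (S (t - s) x)\<close> in \<open>t\<close> combines the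
  uniform Lipschitz bound in the state with strong continuity of the semigroup. Continuity of orbits
  from the left needs a bound on \<open>S\<close> over the dwell interval, and this is what the growth condition
  provides. The decay survives in the left limit at the end of the interval, and the jump inequality
  then contributes a factor \<open>\<mu>\<close>. Induction on the number of impulses gives
  \<open>V t (U t s x) \<le> \<mu> ^ \<kappa> t s * exp (- \<eta> (t - s)) * V s x\<close> (\<open>lyapunov_decay\<close>), and \<open>p\<close>-th roots in the
  bounds of \<open>V\<close> by \<open>norm x powr p\<close> turn this into the estimate for the propagator.

  Conversely, given the stability estimate, the weights in the explicit functional are bounded by
  \<open>M * norm x\<close> since \<open>\<eta> < \<alpha>\<close> and \<open>\<nu> * \<rho> < 1\<close>. The functional is a supremum over the future of the
  trajectory, so moving the state along the flow from \<open>t\<close> to \<open>r\<close> only shrinks the set of times and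
  changes the normalisation: \<open>V r (U r t x) \<le> exp (- \<eta> (r - t)) * (1 / \<nu>) ^ \<kappa> r t * V t x\<close>
  (\<open>functional_along_flow\<close>). Over a short time without impulse this is the Dini inequality; from
  shortly before an impulse to the impulse it is, in the limit, the jump inequality. Regularity in time
  comes from a modulus of continuity that is the same on the whole dwell interval
  (\<open>functional_dwell_variation\<close>), which gives continuity and the left limit at the next impulse at once.
\<close>

section \<open>A comparison principle for Dini derivatives\<close>

text \<open>
  The comparison function \<open>\<phi> t = exp (- \<eta> (t - a)) * v a + \<epsilon> * (t - a)\<close> satisfies \<open>\<phi>' > - \<eta> \<phi>\<close>
  strictly. If \<open>v\<close> ended above \<open>\<phi>\<close>, then at the last time \<open>c\<close> at which \<open>v \<le> \<phi>\<close> the two agree and \<open>v\<close>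
  leaves upwards, so the lower Dini derivative of \<open>v\<close> at \<open>c\<close> is at least \<open>\<phi>' c > - \<eta> * v c\<close>.
  The linear term is a strict supersolution of the decay equation because \<open>\<eta> \<ge> 0\<close>.
\<close>
lemma lower_Dini_decay:
  fixes v :: "real \<Rightarrow> real"
  assumes "a \<le> b" and "\<eta> \<ge> 0" and cont: "continuous_on {a..b} v"
    and dini: "\<And>t. a \<le> t \<Longrightarrow> t < b \<Longrightarrow>
      Liminf (at_right 0) (\<lambda>h. ereal ((v (t + h) - v t) / h)) \<le> ereal (- \<eta> * v t)"
  shows "v b \<le> exp (- \<eta> * (b - a)) * v a"
proof -
  have below: "v b \<le> exp (- \<eta> * (b - a)) * v a + \<epsilon> * (b - a)" if "\<epsilon> > 0" for \<epsilon>
  proof (rule ccontr)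
    define \<phi> where "\<phi> t = exp (- \<eta> * (t - a)) * v a + \<epsilon> * (t - a)" for t
    define K where "K = {t \<in> {a..b}. v t - \<phi> t \<le> 0}"
    assume "\<not> ?thesis"
    hence vb: "v b > \<phi> b" by (simp add: \<phi>_def)
    have cont': "continuous_on {a..b} (\<lambda>t. v t - \<phi> t)"
      unfolding \<phi>_def by (intro continuous_intros cont)
    have "closed K" unfolding K_def
      by (intro continuous_on_closed_Collect_le cont' continuous_on_const) auto
    moreover have "bounded K"
      by (rule bounded_subset[of "{a..b}"]) (auto simp: K_def)
    ultimately have "compact K" by (simp add: compact_eq_bounded_closed)
    moreover have "a \<in> K" using \<open>a \<le> b\<close> by (simp add: K_def \<phi>_def)
    ultimately obtain c where c: "c \<in> K" "\<And>t. t \<in> K \<Longrightarrow> t \<le> c"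
      using compact_attains_sup[of K] by blast
    have cab: "a \<le> c" "c \<le> b" "v c \<le> \<phi> c" using c(1) by (auto simp: K_def)
    with vb have "c < b" by (cases "c = b") auto
    have above: "v t > \<phi> t" if "c < t" "t \<le> b" for t
      using c(2)[of t] that cab by (force simp: K_def)
    have "((\<lambda>t. v t - \<phi> t) \<longlongrightarrow> v c - \<phi> c) (at c within {a..b})"
      using cont' cab by (simp add: continuous_on)
    hence "((\<lambda>t. v t - \<phi> t) \<longlongrightarrow> v c - \<phi> c) (at_right c)"
      using at_within_Icc_at_right[OF \<open>c < b\<close>] \<open>a \<le> c\<close>
      by (metis atLeastatMost_subset_iff order_refl tendsto_within_subset)
    moreover have "\<forall>\<^sub>F t in at_right c. 0 \<le> v t - \<phi> t"
      unfolding eventually_at_right[OF \<open>c < b\<close>] using above \<open>c < b\<close> by force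
    ultimately have "0 \<le> v c - \<phi> c"
      by (rule tendsto_lowerbound) simp
    with cab have vc: "v c = \<phi> c" by simp
    have "(\<phi> has_real_derivative (- \<eta> * exp (- \<eta> * (c - a)) * v a + \<epsilon>)) (at c)"
      unfolding \<phi>_def by (auto intro!: derivative_eq_intros)
    hence "((\<lambda>h. (\<phi> (c + h) - \<phi> c) / h) \<longlongrightarrow> - \<eta> * exp (- \<eta> * (c - a)) * v a + \<epsilon>) (at 0)"
      by (simp add: DERIV_def)
    hence "((\<lambda>h. ereal ((\<phi> (c + h) - \<phi> c) / h)) \<longlongrightarrow>
        ereal (- \<eta> * exp (- \<eta> * (c - a)) * v a + \<epsilon>)) (at_right 0)"
      by (intro tendsto_ereal) (rule filterlim_mono[OF _ order_refl at_le], auto)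
    hence lim: "Liminf (at_right 0) (\<lambda>h. ereal ((\<phi> (c + h) - \<phi> c) / h)) =
        ereal (- \<eta> * exp (- \<eta> * (c - a)) * v a + \<epsilon>)"
      by (intro lim_imp_Liminf) auto
    have "Liminf (at_right 0) (\<lambda>h. ereal ((\<phi> (c + h) - \<phi> c) / h)) \<le>
        Liminf (at_right 0) (\<lambda>h. ereal ((v (c + h) - v c) / h))"
    proof (rule Liminf_mono)
      show "\<forall>\<^sub>F h in at_right 0. ereal ((\<phi> (c + h) - \<phi> c) / h) \<le> ereal ((v (c + h) - v c) / h)"
        using \<open>c < b\<close> above vc
        by (intro eventually_at_rightI[of 0 "b - c"]) (auto simp: divide_right_mono less_imp_le)
    qed
    with lim have "ereal (- \<eta> * exp (- \<eta> * (c - a)) * v a + \<epsilon>) \<le> ereal (- \<eta> * v c)"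
      using order_trans[OF _ dini[OF \<open>a \<le> c\<close> \<open>c < b\<close>]] by metis
    hence "- \<eta> * exp (- \<eta> * (c - a)) * v a + \<epsilon> \<le> - \<eta> * v c" by simp
    hence "\<epsilon> + \<eta> * (\<epsilon> * (c - a)) \<le> 0" by (simp add: vc \<phi>_def algebra_simps)
    moreover have "\<eta> * (\<epsilon> * (c - a)) \<ge> 0" using \<open>\<eta> \<ge> 0\<close> \<open>\<epsilon> > 0\<close> \<open>a \<le> c\<close> by simp
    ultimately show False using \<open>\<epsilon> > 0\<close> by linarith
  qed
  show ?thesis
  proof (rule field_le_epsilon)
    fix e :: real assume "e > 0"
    with below[of "e / (b - a + 1)"] \<open>a \<le> b\<close>
    have "v b \<le> exp (- \<eta> * (b - a)) * v a + e / (b - a + 1) * (b - a)" by simp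
    moreover have "e / (b - a + 1) * (b - a) \<le> e"
      using \<open>a \<le> b\<close> \<open>e > 0\<close> by (simp add: field_simps)
    ultimately show "v b \<le> exp (- \<eta> * (b - a)) * v a + e" by linarith
  qed
qed

section \<open>Impulse times and the propagator\<close>

locale impulsive_system =
  fixes S :: "real \<Rightarrow> 'a::real_normed_vector \<Rightarrow>\<^sub>L 'a" and J :: "'a \<Rightarrow>\<^sub>L 'a" and \<sigma> :: "nat \<Rightarrow> real"
  assumes semigroup: "C0_semigroup S" and sequence: "\<sigma> \<in> impulse_sequences"
begin

abbreviation U :: "real \<Rightarrow> real \<Rightarrow> 'a \<Rightarrow>\<^sub>L 'a" where "U \<equiv> propagator S J \<sigma>"
abbreviation \<kappa> :: "real \<Rightarrow> real \<Rightarrow> nat" where "\<kappa> \<equiv> impulse_count \<sigma>"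

lemma S_0 [simp]: "S 0 = id_blinfun"
  and S_add: "t \<ge> 0 \<Longrightarrow> s \<ge> 0 \<Longrightarrow> S (t + s) = S t o\<^sub>L S s"
  and S_right_continuous_0: "((\<lambda>h. S h x) \<longlongrightarrow> x) (at_right 0)"
  using semigroup by (auto simp: C0_semigroup_def)

lemma strict_mono_sequence: "strict_mono \<sigma>"
  using sequence by (auto simp: impulse_sequences_def strict_mono_Suc_iff)

lemma sequence_0 [simp]: "\<sigma> 0 = 0"
  using sequence by (simp add: impulse_sequences_def)

lemma sequence_nonneg: "\<sigma> k \<ge> 0"
  using strict_mono_less_eq[OF strict_mono_sequence, of 0 k] by simp

lemma finite_impulses [simp]: "finite (impulse_times \<sigma> \<inter> {s<..t})"
proof -
  have "\<forall>\<^sub>F k in sequentially. \<sigma> k > t"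
    using sequence by (auto simp: impulse_sequences_def filterlim_at_top_dense)
  then obtain N where "\<And>k. k \<ge> N \<Longrightarrow> \<sigma> k > t" by (auto simp: eventually_sequentially)
  hence "impulse_times \<sigma> \<inter> {s<..t} \<subseteq> \<sigma> ` {..<N}"
    by (auto simp: impulse_times_def) (meson imageI leD lessThan_iff not_le_imp_less)
  thus ?thesis by (rule finite_subset) simp
qed

lemma dwell_interval_exists:
  assumes "s \<ge> 0"
  obtains k where "\<sigma> k \<le> s" "s < \<sigma> (Suc k)"
proof -
  have "\<forall>\<^sub>F k in sequentially. \<sigma> k > s"
    using sequence by (auto simp: impulse_sequences_def filterlim_at_top_dense)
  then obtain N where "\<sigma> N > s" by (auto simp: eventually_sequentially)
  define m where "m = (LEAST n. \<sigma> n > s)"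
  have m: "\<sigma> m > s" unfolding m_def using \<open>\<sigma> N > s\<close> by (rule LeastI)
  with assms obtain k where k: "m = Suc k" by (cases m) auto
  have "\<not> \<sigma> k > s" using not_less_Least[of k "\<lambda>n. \<sigma> n > s"] k by (simp add: m_def)
  with m k show ?thesis by (intro that[of k]) auto
qed

lemma no_impulse_in_dwell:
  assumes "\<sigma> k \<le> s" "t < \<sigma> (Suc k)"
  shows "impulse_times \<sigma> \<inter> {s<..t} = {}"
proof -
  have False if "s < \<sigma> n" "\<sigma> n \<le> t" for n
  proof -
    have "\<sigma> k < \<sigma> n" "\<sigma> n < \<sigma> (Suc k)" using assms that by linarith+
    thus False using strict_mono_less[OF strict_mono_sequence] by (metis not_less_eq)
  qed
  thus ?thesis by (auto simp: impulse_times_def)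
qed

lemma single_impulse:
  assumes "\<sigma> k \<le> s" "s < \<sigma> (Suc k)"
  shows "impulse_times \<sigma> \<inter> {s<..\<sigma> (Suc k)} = {\<sigma> (Suc k)}"
proof -
  have "\<sigma> n = \<sigma> (Suc k)" if "s < \<sigma> n" "\<sigma> n \<le> \<sigma> (Suc k)" for n
  proof -
    have "\<sigma> k < \<sigma> n" using assms that by linarith
    thus ?thesis using that strict_mono_less[OF strict_mono_sequence]
        strict_mono_less_eq[OF strict_mono_sequence] by (metis le_antisym Suc_leI)
  qed
  thus ?thesis using assms by (auto simp: impulse_times_def)
qed

lemma impulses_split:
  assumes "s \<le> r" "r \<le> t"
  shows "impulse_times \<sigma> \<inter> {s<..t} = (impulse_times \<sigma> \<inter> {s<..r}) \<union> (impulse_times \<sigma> \<inter> {r<..t})"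
  using assms by auto

lemma impulse_count_split:
  assumes "s \<le> r" "r \<le> t"
  shows "\<kappa> t s = \<kappa> t r + \<kappa> r s"
  unfolding impulse_count_def impulses_split[OF assms]
  by (subst card_Un_disjoint) auto

lemma impulse_count_in_dwell: "\<sigma> k \<le> s \<Longrightarrow> t < \<sigma> (Suc k) \<Longrightarrow> \<kappa> t s = 0"
  by (simp add: impulse_count_def no_impulse_in_dwell)

lemma impulse_count_to_impulse: "\<sigma> k \<le> s \<Longrightarrow> s < \<sigma> (Suc k) \<Longrightarrow> \<kappa> (\<sigma> (Suc k)) s = 1"
  by (simp add: impulse_count_def single_impulse)

text \<open>
  The cut time \<open>r\<close> need not be an impulse time: when it falls between two entries of the list, or
  after the last one, the semigroup law splits the corresponding free-flow factor at \<open>r\<close>.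
\<close>
lemma flow_along_append:
  assumes "sorted (xs @ ys)" "s \<le> r" "r \<le> t" "set xs \<subseteq> {s..r}" "set ys \<subseteq> {r..t}"
  shows "flow_along S J (xs @ ys) t s = flow_along S J ys t r o\<^sub>L flow_along S J xs r s"
  using assms
proof (induction xs arbitrary: s)
  case Nil
  show ?case
  proof (cases ys)
    case Nil
    thus ?thesis using S_add[of "t - r" "r - s"] Nil.prems by simp
  next
    case (Cons y ys')
    hence "S (y - s) = S (y - r) o\<^sub>L S (r - s)"
      using S_add[of "y - r" "r - s"] Nil.prems by simp
    thus ?thesis by (intro blinfun_eqI) (simp add: Cons)
  qed
next
  case (Cons x xs)
  hence "flow_along S J (xs @ ys) t x = flow_along S J ys t r o\<^sub>L flow_along S J xs r x"
    by (intro Cons.IH) auto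
  thus ?case by (intro blinfun_eqI) simp
qed

lemma propagator_compose:
  assumes "s \<le> r" "r \<le> t"
  shows "U t s = U t r o\<^sub>L U r s"
proof -
  let ?xs = "sorted_list_of_set (impulse_times \<sigma> \<inter> {s<..r})"
  let ?ys = "sorted_list_of_set (impulse_times \<sigma> \<inter> {r<..t})"
  have sorted: "sorted (?xs @ ?ys)" by (force simp: sorted_append)
  have "sorted_list_of_set (impulse_times \<sigma> \<inter> {s<..t}) = ?xs @ ?ys"
  proof (rule sorted_distinct_set_unique)
    show "set (sorted_list_of_set (impulse_times \<sigma> \<inter> {s<..t})) = set (?xs @ ?ys)"
      using impulses_split[OF assms] by simp
  qed (use sorted in auto)
  thus ?thesis unfolding propagator_def
    using flow_along_append[OF sorted assms] by force
qed

lemma propagator_in_dwell: "\<sigma> k \<le> s \<Longrightarrow> t < \<sigma> (Suc k) \<Longrightarrow> U t s = S (t - s)"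
  by (simp add: propagator_def no_impulse_in_dwell)

lemma propagator_to_impulse:
  "\<sigma> k \<le> s \<Longrightarrow> s < \<sigma> (Suc k) \<Longrightarrow> U (\<sigma> (Suc k)) s = J o\<^sub>L S (\<sigma> (Suc k) - s)"
  by (simp add: propagator_def single_impulse) (intro blinfun_eqI, simp)

lemma propagator_refl [simp]: "U t t = id_blinfun"
  and impulse_count_refl [simp]: "\<kappa> t t = 0"
  by (simp_all add: propagator_def impulse_count_def)

lemma S_modulus_at_0:
  assumes "e > 0"
  shows "\<exists>d>0. \<forall>h. 0 \<le> h \<longrightarrow> h < d \<longrightarrow> norm (S h x - x) < e"
proof -
  have "\<forall>\<^sub>F h in at_right 0. dist (S h x) x < e"
    using S_right_continuous_0 assms by (rule tendstoD)
  then obtain d where d: "d > 0" "\<And>h. 0 < h \<Longrightarrow> h < d \<Longrightarrow> dist (S h x) x < e"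
    by (auto simp: eventually_at_right_field)
  have "norm (S h x - x) < e" if "0 \<le> h" "h < d" for h
    using d(2)[of h] that assms by (cases "h = 0") (auto simp: dist_norm)
  with d(1) show ?thesis by blast
qed

end

section \<open>Exponential stability from a Lyapunov functional\<close>

text \<open>
  Semigroup orbits are compared most naturally with the earlier time first, because only nonnegative
  increments are defined; this criterion asks for just that order.
\<close>
lemma uniformly_continuous_on_ordered_real:
  fixes f :: "real \<Rightarrow> 'b::metric_space"
  assumes "\<And>e. e > 0 \<Longrightarrow>
    \<exists>d>0. \<forall>u\<in>I. \<forall>u'\<in>I. u \<le> u' \<longrightarrow> u' - u < d \<longrightarrow> dist (f u) (f u') < e"
  shows "uniformly_continuous_on I f"
  unfolding uniformly_continuous_on_def
proof (intro allI impI)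
  fix e :: real assume "e > 0"
  from assms[OF this] obtain d where d: "d > 0"
    "\<And>u u'. u \<in> I \<Longrightarrow> u' \<in> I \<Longrightarrow> u \<le> u' \<Longrightarrow> u' - u < d \<Longrightarrow> dist (f u) (f u') < e"
    by blast
  have "dist (f u') (f u) < e" if "u \<in> I" "u' \<in> I" "dist u' u < d" for u u'
    using d(2)[of u u'] d(2)[of u' u] that
    by (cases "u \<le> u'") (auto simp: dist_real_def dist_commute)
  with d(1) show "\<exists>d>0. \<forall>x\<in>I. \<forall>x'\<in>I. dist x' x < d \<longrightarrow> dist (f x') (f x) < e" by blast
qed

lemma lyapunov_functionalD:
  assumes "lyapunov_functional S J \<sigma> p c \<eta> \<mu> V"
  shows "p \<ge> 1" "c \<ge> 1" "\<eta> > 0" "0 < \<mu>" "\<mu> < 1"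
    and "lipschitz_on_bounded_unif V" "piecewise_right_continuous \<sigma> V"
    and "\<And>t x. t \<ge> 0 \<Longrightarrow> norm x powr p \<le> V t x" "\<And>t x. t \<ge> 0 \<Longrightarrow> V t x \<le> c * norm x powr p"
    and "\<And>t x. t \<ge> 0 \<Longrightarrow> lower_Dini S V t x \<le> ereal (- \<eta> * V t x)"
    and "\<And>r x. r \<in> impulse_times \<sigma> \<Longrightarrow> V r (J x) \<le> \<mu> * Lim (at_left r) (\<lambda>t. V t x)"
  using assms unfolding lyapunov_functional_def by blast+

text \<open>
  Replacing a convergent state by its limit does not change the limit of \<open>V\<close>, even though \<open>V\<close> may
  itself vary or jump with \<open>t\<close>. Both continuity along orbits and left limits at impulses use this.
\<close>
lemma lipschitz_on_bounded_unif_tendsto: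
  assumes "lipschitz_on_bounded_unif V" "(f \<longlongrightarrow> y) F" "\<forall>\<^sub>F t in F. t \<ge> 0"
  shows "((\<lambda>t. V t (f t) - V t y) \<longlongrightarrow> 0) F"
proof -
  have pos: "norm y + 1 > 0" using norm_ge_zero[of y] by linarith
  obtain L where L: "\<And>t x z. t \<ge> 0 \<Longrightarrow> norm x < norm y + 1 \<Longrightarrow> norm z < norm y + 1
      \<Longrightarrow> \<bar>V t x - V t z\<bar> \<le> L * norm (x - z)"
    using assms(1) pos unfolding lipschitz_on_bounded_unif_def by meson
  have "\<forall>\<^sub>F t in F. norm (f t) < norm y + 1"
    by (rule order_tendstoD(2)[OF tendsto_norm[OF assms(2)]]) simp
  hence "\<forall>\<^sub>F t in F. norm (V t (f t) - V t y) \<le> L * norm (f t - y)"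
    using assms(3) by eventually_elim (use L in auto)
  moreover have "((\<lambda>t. L * norm (f t - y)) \<longlongrightarrow> 0) F"
    using tendsto_mult_right_zero[OF tendsto_norm_zero[OF LIM_zero[OF assms(2)]]] .
  ultimately show ?thesis by (rule Lim_null_comparison)
qed

context impulsive_system
begin

text \<open>
  For \<open>u \<le> u'\<close> the difference \<open>S u' x - S u x\<close> is \<open>S u\<close> applied to \<open>S (u' - u) x - x\<close>, so a bound on \<open>S\<close> turns
  right continuity at \<open>0\<close> into uniform continuity. The bound is asked for on the half-open interval
  only, since the earlier of two distinct times is less than \<open>T\<close>; the conclusion then includes the
  end point, which is needed for left limits at impulse times.
\<close>
lemma S_continuous_on:
  assumes bound: "\<And>h. 0 \<le> h \<Longrightarrow> h < T \<Longrightarrow> norm (S h) \<le> C"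
  shows "continuous_on {0..T} (\<lambda>t. S t x)"
proof (rule uniformly_continuous_imp_continuous, rule uniformly_continuous_on_ordered_real)
  fix e :: real assume "e > 0"
  hence eC: "e / (\<bar>C\<bar> + 1) > 0" by simp
  obtain d where d: "d > 0" "\<And>h. 0 \<le> h \<Longrightarrow> h < d \<Longrightarrow> norm (S h x - x) < e / (\<bar>C\<bar> + 1)"
    using S_modulus_at_0[OF eC, of x] by auto
  have "dist (S u x) (S u' x) < e" if "u \<in> {0..T}" "u' \<in> {0..T}" "u \<le> u'" "u' - u < d" for u u'
  proof (cases "u = u'")
    case False
    have "S u' x = S u (S (u' - u) x)" using S_add[of u "u' - u"] that by simp
    hence "dist (S u x) (S u' x) = norm (S u (S (u' - u) x - x))"
      by (simp add: dist_norm norm_minus_commute blinfun.diff_right)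
    also have "\<dots> \<le> norm (S u) * norm (S (u' - u) x - x)" by (rule norm_blinfun)
    also have "\<dots> \<le> (\<bar>C\<bar> + 1) * norm (S (u' - u) x - x)"
      using bound[of u] that False by (intro mult_right_mono) auto
    also have "\<dots> < (\<bar>C\<bar> + 1) * (e / (\<bar>C\<bar> + 1))"
      using d(2)[of "u' - u"] that by (intro mult_strict_left_mono) auto
    also have "\<dots> = e"
      by (simp add: field_simps)
    finally show ?thesis .
  qed (use \<open>e > 0\<close> in auto)
  with d(1) show "\<exists>d>0. \<forall>u\<in>{0..T}. \<forall>u'\<in>{0..T}. u \<le> u' \<longrightarrow> u' - u < d \<longrightarrow> dist (S u x) (S u' x) < e"
    by blast
qed

text \<open>
  Started at an impulse time, the propagator is the bare semigroup until the next impulse and the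
  impulse count is zero, so the growth condition bounds \<open>S\<close> by the supremum of \<open>g\<close> over dwell times.
\<close>
lemma growth_condition_dwell_bound:
  assumes "growth_condition S J \<sigma>"
  obtains C where "\<And>k h. 0 \<le> h \<Longrightarrow> h < \<sigma> (Suc k) - \<sigma> k \<Longrightarrow> norm (S h) \<le> C"
proof -
  obtain g \<mu>\<^sub>0 c\<^sub>0 where pos: "c\<^sub>0 > 0" "\<forall>\<tau>\<ge>0. c\<^sub>0 \<le> g \<tau>"
    and growth: "\<forall>s\<ge>0. \<forall>t\<ge>s. \<forall>x. norm (U t s x) \<le> g (t - s) * \<mu>\<^sub>0 ^ \<kappa> t s * norm x"
    and fin: "(SUP \<tau>\<in>{\<tau>. 0 \<le> \<tau> \<and> ereal \<tau> < max_dwell \<sigma>}. ereal (g \<tau>)) < \<infinity>"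
    using assms unfolding growth_condition_def by (elim exE conjE) (rule that)
  define G where "G = (SUP \<tau>\<in>{\<tau>. 0 \<le> \<tau> \<and> ereal \<tau> < max_dwell \<sigma>}. ereal (g \<tau>))"
  have "norm (S h) \<le> real_of_ereal G" if h: "0 \<le> h" "h < \<sigma> (Suc k) - \<sigma> k" for k h
  proof -
    have "ereal h < max_dwell \<sigma>" unfolding max_dwell_def
      using h by (auto simp: less_SUP_iff)
    hence "ereal (g h) \<le> G" unfolding G_def using h by (intro SUP_upper) auto
    hence g: "g h \<le> real_of_ereal G" using fin unfolding G_def[symmetric] by (cases G) auto
    have "norm (S h x) \<le> g h * norm x" for x
      using growth[rule_format, of "\<sigma> k" "\<sigma> k + h" x] h sequence_nonneg[of k]
        propagator_in_dwell[of k "\<sigma> k" "\<sigma> k + h"] impulse_count_in_dwell[of k "\<sigma> k" "\<sigma> k + h"]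
      by simp
    moreover have "0 \<le> g h" using pos(1) pos(2)[rule_format, of h] h by linarith
    ultimately have "norm (S h) \<le> g h" by (intro norm_blinfun_bound)
    with g show ?thesis by simp
  qed
  thus ?thesis by (rule that)
qed

lemma lyapunov_decay_in_dwell:
  assumes V: "lyapunov_functional S J \<sigma> p c \<eta> \<mu> V"
    and bound: "\<And>k h. 0 \<le> h \<Longrightarrow> h < \<sigma> (Suc k) - \<sigma> k \<Longrightarrow> norm (S h) \<le> C"
    and st: "\<sigma> k \<le> s" "s \<le> t" "t < \<sigma> (Suc k)"
  shows "V t (S (t - s) x) \<le> exp (- \<eta> * (t - s)) * V s x"
proof -
  have s: "s \<ge> 0" using st sequence_nonneg[of k] by linarith
  define v where "v u = V u (S (u - s) x)" for u
  have "continuous_on {s..t} v"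
    unfolding continuous_on_def
  proof
    fix u assume u: "u \<in> {s..t}"
    let ?y = "S (u - s) x"
    have "continuous_on {0..t - s} (\<lambda>r. S r x)"
      by (rule S_continuous_on[of _ C]) (use bound[of _ k] st in auto)
    hence "continuous_on {s..t} (\<lambda>r. S (r - s) x)"
      by (rule continuous_on_compose2) (auto intro!: continuous_intros)
    hence "((\<lambda>r. S (r - s) x) \<longlongrightarrow> ?y) (at u within {s..t})"
      using u by (simp add: continuous_on_def)
    hence "((\<lambda>r. V r (S (r - s) x) - V r ?y) \<longlongrightarrow> 0) (at u within {s..t})"
      using s by (intro lipschitz_on_bounded_unif_tendsto lyapunov_functionalD[OF V])
        (auto simp: eventually_at_filter)
    moreover have "continuous_on {\<sigma> k..<\<sigma> (Suc k)} (\<lambda>r. V r ?y)"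
      using lyapunov_functionalD(7)[OF V] by (simp add: piecewise_right_continuous_def)
    hence "continuous_on {s..t} (\<lambda>r. V r ?y)"
      by (rule continuous_on_subset) (use st in auto)
    hence "((\<lambda>r. V r ?y) \<longlongrightarrow> V u ?y) (at u within {s..t})"
      using u by (simp add: continuous_on_def)
    ultimately have "((\<lambda>r. (V r (S (r - s) x) - V r ?y) + V r ?y) \<longlongrightarrow> 0 + V u ?y) (at u within {s..t})"
      by (rule tendsto_add)
    thus "(v \<longlongrightarrow> v u) (at u within {s..t})" by (simp add: v_def[abs_def])
  qed
  moreover have "Liminf (at_right 0) (\<lambda>h. ereal ((v (u + h) - v u) / h)) \<le> ereal (- \<eta> * v u)"
    if "s \<le> u" "u < t" for u
  proof -
    have "\<forall>\<^sub>F h in at_right 0. S (u + h - s) x = S h (S (u - s) x)"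
    proof (rule eventually_at_rightI)
      fix h :: real assume "h \<in> {0<..<1}"
      thus "S (u + h - s) x = S h (S (u - s) x)"
        using S_add[of h "u - s"] that by (simp add: algebra_simps)
    qed simp
    hence "Liminf (at_right 0) (\<lambda>h. ereal ((v (u + h) - v u) / h)) = lower_Dini S V u (S (u - s) x)"
      unfolding lower_Dini_def by (intro Liminf_eq) (auto elim!: eventually_mono simp: v_def)
    moreover have "\<dots> \<le> ereal (- \<eta> * V u (S (u - s) x))"
      using s that by (intro lyapunov_functionalD[OF V]) simp
    ultimately show ?thesis by (simp add: v_def)
  qed
  ultimately have "v t \<le> exp (- \<eta> * (t - s)) * v s"
    using st lyapunov_functionalD(3)[OF V] by (intro lower_Dini_decay) auto
  thus ?thesis by (simp add: v_def)
qed

text \<open>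
  The jump inequality refers to the left limit of \<open>V\<close> at the fixed state \<open>S (\<sigma> (Suc k) - s) x\<close>, whereas
  the decay within the dwell interval concerns the moving state \<open>S (t - s) x\<close>. By the uniform Lipschitz
  bound both have the same left limit at the impulse.
\<close>
lemma lyapunov_decay_to_impulse:
  assumes V: "lyapunov_functional S J \<sigma> p c \<eta> \<mu> V"
    and bound: "\<And>k h. 0 \<le> h \<Longrightarrow> h < \<sigma> (Suc k) - \<sigma> k \<Longrightarrow> norm (S h) \<le> C"
    and s: "\<sigma> k \<le> s" "s < \<sigma> (Suc k)"
  shows "V (\<sigma> (Suc k)) (U (\<sigma> (Suc k)) s x) \<le> \<mu> * (exp (- \<eta> * (\<sigma> (Suc k) - s)) * V s x)"
proof -
  let ?b = "\<sigma> (Suc k)"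
  let ?y = "S (?b - s) x"
  have s0: "s \<ge> 0" using s sequence_nonneg[of k] by linarith
  have "\<exists>l. ((\<lambda>t. V t ?y) \<longlongrightarrow> l) (at_left ?b)"
    using lyapunov_functionalD(7)[OF V] by (simp add: piecewise_right_continuous_def)
  then obtain l where l: "((\<lambda>t. V t ?y) \<longlongrightarrow> l) (at_left ?b)" ..
  have near: "\<forall>\<^sub>F t in at_left ?b. t \<in> {s<..<?b}"
    by (rule eventually_at_leftI[OF _ s(2)])
  have "continuous_on {0..?b - s} (\<lambda>r. S r x)"
    by (rule S_continuous_on[of _ C]) (use bound[of _ k] s in auto)
  hence "continuous_on {s..?b} (\<lambda>r. S (r - s) x)"
    by (rule continuous_on_compose2) (auto intro!: continuous_intros)
  hence "((\<lambda>r. S (r - s) x) \<longlongrightarrow> ?y) (at ?b within {s..?b})"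
    using s by (simp add: continuous_on_def)
  hence "((\<lambda>r. S (r - s) x) \<longlongrightarrow> ?y) (at_left ?b)"
    using at_within_Icc_at_left[OF s(2)] by simp
  hence "((\<lambda>t. V t (S (t - s) x) - V t ?y) \<longlongrightarrow> 0) (at_left ?b)"
    using near s0 by (intro lipschitz_on_bounded_unif_tendsto lyapunov_functionalD[OF V])
      (auto elim!: eventually_mono)
  from tendsto_add[OF this l] have "((\<lambda>t. V t (S (t - s) x)) \<longlongrightarrow> l) (at_left ?b)" by simp
  moreover have "((\<lambda>t. exp (- \<eta> * (t - s)) * V s x) \<longlongrightarrow> exp (- \<eta> * (?b - s)) * V s x) (at_left ?b)"
    by (intro tendsto_intros)
  moreover have "\<forall>\<^sub>F t in at_left ?b. V t (S (t - s) x) \<le> exp (- \<eta> * (t - s)) * V s x"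
    using near by eventually_elim (use lyapunov_decay_in_dwell[OF V bound] s in auto)
  ultimately have l_le: "l \<le> exp (- \<eta> * (?b - s)) * V s x"
    by (intro tendsto_le[of "at_left ?b"]) auto
  have "V ?b (J ?y) \<le> \<mu> * Lim (at_left ?b) (\<lambda>t. V t ?y)"
    by (rule lyapunov_functionalD[OF V]) (auto simp: impulse_times_def)
  also have "Lim (at_left ?b) (\<lambda>t. V t ?y) = l"
    using l by (intro tendsto_Lim) auto
  also have "\<mu> * l \<le> \<mu> * (exp (- \<eta> * (?b - s)) * V s x)"
    using l_le lyapunov_functionalD(4)[OF V] by (intro mult_left_mono) auto
  finally show ?thesis using propagator_to_impulse[OF s] by simp
qed

lemma lyapunov_decay:
  assumes V: "lyapunov_functional S J \<sigma> p c \<eta> \<mu> V"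
    and bound: "\<And>k h. 0 \<le> h \<Longrightarrow> h < \<sigma> (Suc k) - \<sigma> k \<Longrightarrow> norm (S h) \<le> C"
    and "0 \<le> s" "s \<le> t"
  shows "V t (U t s x) \<le> \<mu> ^ \<kappa> t s * exp (- \<eta> * (t - s)) * V s x"
  using \<open>0 \<le> s\<close> \<open>s \<le> t\<close>
proof (induction "\<kappa> t s" arbitrary: s x rule: less_induct)
  case less
  obtain k where k: "\<sigma> k \<le> s" "s < \<sigma> (Suc k)"
    using dwell_interval_exists less.prems by blast
  show ?case
  proof (cases "t < \<sigma> (Suc k)")
    case True
    thus ?thesis
      using lyapunov_decay_in_dwell[OF V bound k(1) less.prems(2) True]
      by (simp add: propagator_in_dwell[OF k(1) True] impulse_count_in_dwell[OF k(1) True])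
  next
    case False
    let ?b = "\<sigma> (Suc k)"
    let ?y = "U ?b s x"
    have b: "s \<le> ?b" "?b \<le> t" using k False by auto
    have count: "\<kappa> t s = Suc (\<kappa> t ?b)"
      using impulse_count_split[OF b] impulse_count_to_impulse[OF k] by simp
    have "V t (U t s x) = V t (U t ?b ?y)" using propagator_compose[OF b] by simp
    also have "\<dots> \<le> \<mu> ^ \<kappa> t ?b * exp (- \<eta> * (t - ?b)) * V ?b ?y"
      using count b by (intro less.hyps) (auto simp: sequence_nonneg)
    also have "\<dots> \<le> \<mu> ^ \<kappa> t ?b * exp (- \<eta> * (t - ?b)) * (\<mu> * (exp (- \<eta> * (?b - s)) * V s x))"
      using lyapunov_functionalD(4)[OF V]
      by (intro mult_left_mono lyapunov_decay_to_impulse[OF V bound k]) auto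
    also have "\<dots> = \<mu> ^ \<kappa> t s * (exp (- \<eta> * (t - ?b)) * exp (- \<eta> * (?b - s))) * V s x"
      by (simp add: count)
    also have "exp (- \<eta> * (t - ?b)) * exp (- \<eta> * (?b - s)) = exp (- \<eta> * (t - s))"
      by (simp add: exp_add[symmetric] algebra_simps)
    finally show ?thesis .
  qed
qed

theorem lyapunov_imp_strongly_GES:
  assumes V: "lyapunov_functional S J \<sigma> p c \<eta> \<mu> V"
    and bound: "\<And>k h. 0 \<le> h \<Longrightarrow> h < \<sigma> (Suc k) - \<sigma> k \<Longrightarrow> norm (S h) \<le> C"
  shows "strongly_GES S J \<sigma>"
proof -
  have p: "p \<ge> 1" and c: "c \<ge> 1" and \<eta>: "\<eta> > 0" and \<mu>: "0 < \<mu>" "\<mu> < 1"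
    by (rule lyapunov_functionalD[OF V])+
  define M \<rho> where "M = c powr (1 / p)" and "\<rho> = \<mu> powr (1 / p)"
  have "norm (U t s) \<le> M * \<rho> ^ \<kappa> t s * exp (- (\<eta> / p) * (t - s))" if st: "0 \<le> s" "s \<le> t" for s t
  proof (rule norm_blinfun_bound)
    show "0 \<le> M * \<rho> ^ \<kappa> t s * exp (- (\<eta> / p) * (t - s))" by (simp add: M_def \<rho>_def)
    fix x
    let ?E = "exp (- \<eta> * (t - s))"
    have "norm (U t s x) powr p \<le> V t (U t s x)"
      using st by (intro lyapunov_functionalD[OF V]) simp
    also have "\<dots> \<le> \<mu> ^ \<kappa> t s * ?E * V s x" by (rule lyapunov_decay[OF V bound st])
    also have "\<dots> \<le> \<mu> ^ \<kappa> t s * ?E * (c * norm x powr p)"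
      using st \<mu> by (intro mult_left_mono lyapunov_functionalD(9)[OF V]) auto
    also have "\<dots> = c * \<mu> ^ \<kappa> t s * ?E * norm x powr p" by simp
    finally have "(norm (U t s x) powr p) powr (1 / p) \<le>
        (c * \<mu> ^ \<kappa> t s * ?E * norm x powr p) powr (1 / p)"
      using p by (intro powr_mono2) auto
    also have "\<dots> = M * (\<mu> ^ \<kappa> t s) powr (1 / p) * ?E powr (1 / p) * (norm x powr p) powr (1 / p)"
      using c \<mu> by (simp add: powr_mult M_def)
    also have "(\<mu> ^ \<kappa> t s) powr (1 / p) = \<rho> ^ \<kappa> t s"
      using \<mu> by (simp add: \<rho>_def powr_powr powr_power flip: powr_realpow)
    also have "?E powr (1 / p) = exp (- (\<eta> / p) * (t - s))"
      by (simp add: exp_powr_real)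
    finally show "norm (U t s x) \<le> M * \<rho> ^ \<kappa> t s * exp (- (\<eta> / p) * (t - s)) * norm x"
      using p by (simp add: powr_powr)
  qed
  moreover have "M \<ge> 1" using c p by (simp add: M_def ge_one_powr_ge_zero)
  moreover have "0 < \<rho>" "\<rho> < 1" using \<mu> p powr_less_mono2[of "1 / p" \<mu> 1] by (auto simp: \<rho>_def)
  ultimately have "GES_estimate S J \<sigma> M (\<eta> / p) \<rho>"
    using \<eta> p by (auto simp: GES_estimate_def)
  thus ?thesis unfolding strongly_GES_def by blast
qed

end

section \<open>The explicit functional\<close>

text \<open>
  The parameters are those of the stability estimate together with an admissible choice of the
  exponential rate \<open>\<eta>\<close> and the impulse weight \<open>\<nu>\<close> in the functional.
\<close>
locale ges_impulsive_system = impulsive_system S J \<sigma>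
  for S :: "real \<Rightarrow> 'a::real_normed_vector \<Rightarrow>\<^sub>L 'a" and J :: "'a \<Rightarrow>\<^sub>L 'a" and \<sigma> :: "nat \<Rightarrow> real" +
  fixes M \<alpha> \<rho> \<eta> \<nu> :: real
  assumes ges: "GES_estimate S J \<sigma> M \<alpha> \<rho>"
    and \<eta>_pos: "0 < \<eta>" and \<eta>_less: "\<eta> < \<alpha>" and \<nu>_gt: "1 < \<nu>" and \<nu>_less: "\<nu> < 1 / \<rho>"
begin

abbreviation W :: "real \<Rightarrow> 'a \<Rightarrow> real \<Rightarrow> real" where "W \<equiv> explicit_weight S J \<sigma> \<eta> \<nu>"
abbreviation V :: "real \<Rightarrow> 'a \<Rightarrow> real" where "V \<equiv> explicit_functional S J \<sigma> \<eta> \<nu>"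

lemma M_ge: "M \<ge> 1" and \<rho>_pos: "\<rho> > 0"
  using ges by (auto simp: GES_estimate_def)

lemma weight_le:
  assumes "0 \<le> t" "t \<le> \<tau>"
  shows "W t x \<tau> \<le> M * norm x"
proof -
  have "norm (U \<tau> t x) \<le> norm (U \<tau> t) * norm x" by (rule norm_blinfun)
  also have "\<dots> \<le> M * \<rho> ^ \<kappa> \<tau> t * exp (- \<alpha> * (\<tau> - t)) * norm x"
    using ges assms by (intro mult_right_mono) (auto simp: GES_estimate_def)
  finally have norm_U: "norm (U \<tau> t x) \<le> M * \<rho> ^ \<kappa> \<tau> t * exp (- \<alpha> * (\<tau> - t)) * norm x" .
  have le0: "(\<eta> - \<alpha>) * (\<tau> - t) \<le> 0"
    using \<eta>_less assms by (simp add: mult_nonpos_nonneg)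
  from norm_U have "W t x \<tau> \<le>
      exp (\<eta> * (\<tau> - t)) * \<nu> ^ \<kappa> \<tau> t * (M * \<rho> ^ \<kappa> \<tau> t * exp (- \<alpha> * (\<tau> - t)) * norm x)"
    unfolding explicit_weight_def using \<nu>_gt by (intro mult_left_mono) auto
  also have "\<dots> = (exp (\<eta> * (\<tau> - t)) * exp (- \<alpha> * (\<tau> - t))) * (\<nu> * \<rho>) ^ \<kappa> \<tau> t * (M * norm x)"
    by (simp add: power_mult_distrib)
  also have "exp (\<eta> * (\<tau> - t)) * exp (- \<alpha> * (\<tau> - t)) = exp ((\<eta> - \<alpha>) * (\<tau> - t))"
    by (simp add: exp_add[symmetric] algebra_simps)
  also have "exp ((\<eta> - \<alpha>) * (\<tau> - t)) * (\<nu> * \<rho>) ^ \<kappa> \<tau> t * (M * norm x) \<le> 1 * 1 * (M * norm x)"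
    using le0 \<nu>_gt \<nu>_less \<rho>_pos M_ge
    by (intro mult_mono mult_right_mono power_le_one) (auto simp: pos_less_divide_eq)
  finally show ?thesis by simp
qed

lemma bdd_above_weight: "0 \<le> t \<Longrightarrow> bdd_above (W t x ` {t..})"
  by (rule bdd_aboveI[of _ "M * norm x"]) (auto simp: weight_le)

lemma weight_le_functional: "0 \<le> t \<Longrightarrow> t \<le> \<tau> \<Longrightarrow> W t x \<tau> \<le> V t x"
  unfolding explicit_functional_def by (intro cSUP_upper bdd_above_weight) auto

lemma functional_leI: "(\<And>\<tau>. t \<le> \<tau> \<Longrightarrow> W t x \<tau> \<le> B) \<Longrightarrow> V t x \<le> B"
  unfolding explicit_functional_def by (intro cSUP_least) auto

lemma norm_le_functional: "0 \<le> t \<Longrightarrow> norm x \<le> V t x"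
  using weight_le_functional[of t t x] by (simp add: explicit_weight_def)

lemma functional_le: "0 \<le> t \<Longrightarrow> V t x \<le> M * norm x"
  by (intro functional_leI weight_le)

text \<open>
  The weight is multiplicative along trajectories, since exponent, impulse count and propagator are
  all additive or multiplicative under splitting the time interval.
\<close>
lemma weight_along_flow:
  assumes "t \<le> r" "r \<le> \<tau>"
  shows "W t x \<tau> = exp (\<eta> * (r - t)) * \<nu> ^ \<kappa> r t * W r (U r t x) \<tau>"
proof -
  have "exp (\<eta> * (\<tau> - t)) = exp (\<eta> * (\<tau> - r)) * exp (\<eta> * (r - t))"
    by (simp add: exp_add[symmetric] algebra_simps)
  thus ?thesis
    by (simp add: explicit_weight_def impulse_count_split[OF assms] propagator_compose[OF assms]
        power_add)
qed

text \<open>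
  This one inequality contains both Lyapunov conditions: with no impulse between \<open>t\<close> and \<open>r\<close> it gives
  the exponential decrease, with one impulse it gives the factor \<open>1 / \<nu>\<close>. Up to the normalising
  factor, the supremum on the left is taken over fewer times than the one on the right.
\<close>
lemma functional_along_flow:
  assumes "0 \<le> t" "t \<le> r"
  shows "V r (U r t x) \<le> exp (- \<eta> * (r - t)) * (1 / \<nu>) ^ \<kappa> r t * V t x"
proof (rule functional_leI)
  fix \<tau> assume "r \<le> \<tau>"
  let ?q = "exp (\<eta> * (r - t)) * \<nu> ^ \<kappa> r t"
  have "?q * W r (U r t x) \<tau> \<le> V t x"
    using weight_le_functional[of t \<tau> x] weight_along_flow[of t r \<tau> x] assms \<open>r \<le> \<tau>\<close> by simp
  moreover have "?q > 0" using \<nu>_gt by simp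
  ultimately have "W r (U r t x) \<tau> \<le> V t x / ?q" by (simp add: pos_le_divide_eq mult.commute)
  also have "\<dots> = inverse (exp (\<eta> * (r - t))) * (1 / \<nu>) ^ \<kappa> r t * V t x"
    by (simp add: divide_inverse power_inverse)
  also have "inverse (exp (\<eta> * (r - t))) = exp (- \<eta> * (r - t))"
    by (simp flip: exp_minus)
  finally show "W r (U r t x) \<tau> \<le> exp (- \<eta> * (r - t)) * (1 / \<nu>) ^ \<kappa> r t * V t x" .
qed

text \<open>A supremum of seminorms, each bounded by \<open>M\<close> times the norm, is a seminorm with the same bound.\<close>
lemma functional_lipschitz:
  assumes "0 \<le> t"
  shows "\<bar>V t x - V t y\<bar> \<le> M * norm (x - y)"
proof -
  have "V t x \<le> V t y + M * norm (x - y)" for x y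
  proof (rule functional_leI)
    fix \<tau> assume "t \<le> \<tau>"
    have "norm (U \<tau> t x) \<le> norm (U \<tau> t y) + norm (U \<tau> t (x - y))"
      by (simp add: blinfun.diff_right norm_triangle_sub)
    hence "W t x \<tau> \<le> exp (\<eta> * (\<tau> - t)) * \<nu> ^ \<kappa> \<tau> t * (norm (U \<tau> t y) + norm (U \<tau> t (x - y)))"
      unfolding explicit_weight_def using \<nu>_gt by (intro mult_left_mono) auto
    also have "\<dots> = W t y \<tau> + W t (x - y) \<tau>"
      by (simp add: explicit_weight_def algebra_simps)
    also have "\<dots> \<le> V t y + M * norm (x - y)"
      using assms \<open>t \<le> \<tau>\<close> by (intro add_mono weight_le_functional weight_le)
    finally show "W t x \<tau> \<le> V t y + M * norm (x - y)" .
  qed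
  from this[of x y] this[of y x] show ?thesis by (simp add: norm_minus_commute abs_le_iff)
qed

text \<open>
  Split the supremum defining \<open>V t x\<close> at \<open>t'\<close>. The part after \<open>t'\<close> is, up to the factor
  \<open>exp (\<eta> (t' - t))\<close>, the value of \<open>V t'\<close> at \<open>S (t' - t) x\<close>, a state within \<open>\<omega>\<close> of \<open>x\<close>. The part before
  \<open>t'\<close> is close to \<open>norm x\<close>, which never exceeds \<open>V t' x\<close>, so it cannot raise the supremum by much.
  The estimate depends on \<open>t\<close> and \<open>t'\<close> only through \<open>t' - t\<close>; this uniformity is the source of the
  left limits.
\<close>
lemma functional_dwell_variation:
  assumes k: "\<sigma> k \<le> t" "t \<le> t'" "t' < \<sigma> (Suc k)"
    and \<omega>: "\<And>h. 0 \<le> h \<Longrightarrow> h \<le> t' - t \<Longrightarrow> norm (S h x - x) \<le> \<omega>"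
  shows "\<bar>V t x - V t' x\<bar> \<le> (exp (\<eta> * (t' - t)) - 1) * (M * norm x) + exp (\<eta> * (t' - t)) * (M * \<omega>)"
proof -
  define E where "E = exp (\<eta> * (t' - t))"
  have t: "0 \<le> t" "0 \<le> t'" using k sequence_nonneg[of k] by linarith+
  have E: "E \<ge> 1" using \<eta>_pos k by (simp add: E_def)
  have \<omega>0: "\<omega> \<ge> 0" using \<omega>[of 0] k by simp
  let ?y = "S (t' - t) x"
  have flow: "U t' t = S (t' - t)" "\<kappa> t' t = 0"
    using k by (auto simp: propagator_in_dwell impulse_count_in_dwell)
  have "\<bar>V t' ?y - V t' x\<bar> \<le> M * norm (?y - x)" by (rule functional_lipschitz[OF t(2)])
  also have "\<dots> \<le> M * \<omega>" using \<omega> k M_ge by (intro mult_left_mono) auto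
  finally have y: "\<bar>V t' ?y - V t' x\<bar> \<le> M * \<omega>" .

  have "V t' ?y \<le> exp (- \<eta> * (t' - t)) * V t x"
    using functional_along_flow[OF t(1) k(2), of x] flow by simp
  also have "\<dots> \<le> 1 * V t x"
    using \<eta>_pos k order_trans[OF norm_ge_zero norm_le_functional[OF t(1)]]
    by (intro mult_right_mono) auto
  finally have "V t' x - V t x \<le> M * \<omega>" using y by simp
  moreover have "M * \<omega> \<le> E * (M * \<omega>)" using mult_right_mono[OF E, of "M * \<omega>"] \<omega>0 M_ge by simp
  moreover have "(E - 1) * (M * norm x) \<ge> 0" using E M_ge by simp
  ultimately have lower: "V t' x - V t x \<le> (E - 1) * (M * norm x) + E * (M * \<omega>)" by linarith

  have "V t x \<le> E * (V t' x + M * \<omega>)"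
  proof (rule functional_leI)
    fix \<tau> assume "t \<le> \<tau>"
    show "W t x \<tau> \<le> E * (V t' x + M * \<omega>)"
    proof (cases "\<tau> \<le> t'")
      case True
      have "W t x \<tau> = exp (\<eta> * (\<tau> - t)) * norm (S (\<tau> - t) x)"
        using k True by (simp add: explicit_weight_def propagator_in_dwell impulse_count_in_dwell)
      also have "\<dots> \<le> E * (V t' x + M * \<omega>)"
      proof (rule mult_mono)
        have "norm (S (\<tau> - t) x) \<le> norm x + norm (S (\<tau> - t) x - x)" by (rule norm_triangle_sub)
        also have "\<dots> \<le> V t' x + \<omega>"
          using \<open>t \<le> \<tau>\<close> True by (intro add_mono norm_le_functional t \<omega>) auto
        also have "\<omega> \<le> M * \<omega>" using M_ge \<omega>0 by (simp add: mult_le_cancel_right1)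
        finally show "norm (S (\<tau> - t) x) \<le> V t' x + M * \<omega>" by simp
      qed (use True \<eta>_pos in \<open>auto simp: E_def\<close>)
      finally show ?thesis .
    next
      case False
      have "W t x \<tau> = E * W t' ?y \<tau>"
        using weight_along_flow[of t t' \<tau> x] False k flow by (simp add: E_def)
      also have "\<dots> \<le> E * V t' ?y"
        using False E t by (intro mult_left_mono weight_le_functional) auto
      also have "\<dots> \<le> E * (V t' x + M * \<omega>)" using y E by (intro mult_left_mono) auto
      finally show ?thesis .
    qed
  qed
  moreover have "(E - 1) * V t' x \<le> (E - 1) * (M * norm x)"
    using E functional_le[OF t(2)] by (intro mult_left_mono) auto
  ultimately have "V t x - V t' x \<le> (E - 1) * (M * norm x) + E * (M * \<omega>)"
    by (simp add: algebra_simps)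
  with lower show ?thesis by (simp add: E_def abs_le_iff)
qed

lemma functional_uniformly_continuous_in_dwell:
  "uniformly_continuous_on {\<sigma> k..<\<sigma> (Suc k)} (\<lambda>t. V t x)"
proof (rule uniformly_continuous_on_ordered_real)
  fix e :: real assume "e > 0"
  (* Half of e pays for the first term of the variation. The other half pays for the second,
     using exp (eta * delta) < 2 and omega = e / (4 * M). *)
  have "((\<lambda>\<delta>. exp (\<eta> * \<delta>)) \<longlongrightarrow> exp (\<eta> * 0)) (at_right 0)"
    "((\<lambda>\<delta>. (exp (\<eta> * \<delta>) - 1) * (M * norm x)) \<longlongrightarrow> (exp (\<eta> * 0) - 1) * (M * norm x)) (at_right 0)"
    by (intro tendsto_intros)+
  note lim = order_tendstoD(2)[OF this(1), of 2] order_tendstoD(2)[OF this(2), of "e / 2"]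
  have "\<forall>\<^sub>F \<delta> in at_right 0. exp (\<eta> * \<delta>) < 2 \<and> (exp (\<eta> * \<delta>) - 1) * (M * norm x) < e / 2"
    using lim \<open>e > 0\<close> by (intro eventually_conj) auto
  then obtain d1 where d1: "d1 > 0"
    "\<And>\<delta>. 0 < \<delta> \<Longrightarrow> \<delta> < d1 \<Longrightarrow> exp (\<eta> * \<delta>) < 2 \<and> (exp (\<eta> * \<delta>) - 1) * (M * norm x) < e / 2"
    by (auto simp: eventually_at_right_field)
  have eM: "e / (4 * M) > 0" using \<open>e > 0\<close> M_ge by simp
  obtain d2 where d2: "d2 > 0" "\<And>h. 0 \<le> h \<Longrightarrow> h < d2 \<Longrightarrow> norm (S h x - x) < e / (4 * M)"
    using S_modulus_at_0[OF eM, of x] by auto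
  have "dist (V u x) (V u' x) < e"
    if "u \<in> {\<sigma> k..<\<sigma> (Suc k)}" "u' \<in> {\<sigma> k..<\<sigma> (Suc k)}" "u \<le> u'" "u' - u < min d1 d2" for u u'
  proof (cases "u = u'")
    case False
    let ?E = "exp (\<eta> * (u' - u))"
    have M_cancel: "M * (e / (4 * M)) = e / 4" using M_ge by simp
    have "\<bar>V u x - V u' x\<bar> \<le> (?E - 1) * (M * norm x) + ?E * (M * (e / (4 * M)))"
      using that by (intro functional_dwell_variation[of k] less_imp_le[OF d2(2)]) auto
    moreover have "(?E - 1) * (M * norm x) < e / 2" "?E < 2"
      using d1(2)[of "u' - u"] that False by auto
    moreover have "?E * (e / 4) \<le> 2 * (e / 4)"
      using \<open>?E < 2\<close> \<open>e > 0\<close> by (intro mult_right_mono) auto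
    ultimately show ?thesis unfolding M_cancel dist_real_def by linarith
  qed (use \<open>e > 0\<close> in auto)
  with d1(1) d2(1) show "\<exists>d>0. \<forall>u\<in>{\<sigma> k..<\<sigma> (Suc k)}. \<forall>u'\<in>{\<sigma> k..<\<sigma> (Suc k)}.
      u \<le> u' \<longrightarrow> u' - u < d \<longrightarrow> dist (V u x) (V u' x) < e"
    by (intro exI[of _ "min d1 d2"]) auto
qed

lemma functional_left_limit:
  obtains l where "((\<lambda>t. V t x) \<longlongrightarrow> l) (at_left (\<sigma> (Suc k)))"
proof -
  have less: "\<sigma> k < \<sigma> (Suc k)" using strict_mono_less[OF strict_mono_sequence] by simp
  have "\<sigma> (Suc k) \<in> closure {\<sigma> k..<\<sigma> (Suc k)}" using less by simp
  with functional_uniformly_continuous_in_dwell obtain l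
    where "((\<lambda>t. V t x) \<longlongrightarrow> l) (at (\<sigma> (Suc k)) within {\<sigma> k..<\<sigma> (Suc k)})"
    by (rule uniformly_continuous_on_extension_at_closure)
  moreover have "at (\<sigma> (Suc k)) within {\<sigma> k..<\<sigma> (Suc k)} = at_left (\<sigma> (Suc k))"
    using less by (intro at_within_nhd[of _ "{\<sigma> k<..}"]) auto
  ultimately show ?thesis using that by simp
qed

text \<open>
  Flowing \<open>x\<close> from \<open>t < \<sigma> (Suc k)\<close> through the impulse gives the state \<open>J (S (\<sigma> (Suc k) - t) x)\<close>, which
  tends to \<open>J x\<close> as \<open>t\<close> approaches the impulse from the left. So the inequality along the flow passes
  to the limit.
\<close>
lemma functional_jump: "V (\<sigma> (Suc k)) (J x) \<le> 1 / \<nu> * Lim (at_left (\<sigma> (Suc k))) (\<lambda>t. V t x)"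
proof -
  let ?b = "\<sigma> (Suc k)"
  obtain l where l: "((\<lambda>t. V t x) \<longlongrightarrow> l) (at_left ?b)" by (rule functional_left_limit)
  have less: "\<sigma> k < ?b" using strict_mono_less[OF strict_mono_sequence] by simp
  have near: "\<forall>\<^sub>F t in at_left ?b. t \<in> {\<sigma> k<..<?b}" by (rule eventually_at_leftI[OF _ less])
  have "filterlim (\<lambda>t. ?b - t) (at_right 0) (at_left ?b)"
    unfolding filterlim_at
  proof
    have "((\<lambda>t. ?b - t) \<longlongrightarrow> ?b - ?b) (at_left ?b)" by (intro tendsto_intros)
    thus "filterlim (\<lambda>t. ?b - t) (nhds 0) (at_left ?b)" by simp
    show "\<forall>\<^sub>F t in at_left ?b. ?b - t \<in> {0<..} \<and> ?b - t \<noteq> 0" using near by eventually_elim auto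
  qed
  with S_right_continuous_0 have "((\<lambda>t. S (?b - t) x) \<longlongrightarrow> x) (at_left ?b)"
    by (rule filterlim_compose)
  hence "((\<lambda>t. J (S (?b - t) x)) \<longlongrightarrow> J x) (at_left ?b)" by (intro tendsto_intros)
  hence "((\<lambda>t. M * norm (J (S (?b - t) x) - J x)) \<longlongrightarrow> 0) (at_left ?b)"
    by (intro tendsto_mult_right_zero tendsto_norm_zero LIM_zero)
  hence "((\<lambda>t. V ?b (J (S (?b - t) x)) - V ?b (J x)) \<longlongrightarrow> 0) (at_left ?b)"
    by (rule Lim_null_comparison[rotated]) (simp add: functional_lipschitz sequence_nonneg)
  hence "((\<lambda>t. V ?b (J (S (?b - t) x))) \<longlongrightarrow> V ?b (J x)) (at_left ?b)"
    by (rule LIM_zero_cancel)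
  moreover have "((\<lambda>t. 1 / \<nu> * V t x) \<longlongrightarrow> 1 / \<nu> * l) (at_left ?b)"
    by (intro tendsto_intros l)
  moreover have "\<forall>\<^sub>F t in at_left ?b. V ?b (J (S (?b - t) x)) \<le> 1 / \<nu> * V t x"
    using near
  proof eventually_elim
    case (elim t)
    hence t: "0 \<le> t" "t \<le> ?b" "\<sigma> k \<le> t" "t < ?b" using sequence_nonneg[of k] by auto
    have "V ?b (J (S (?b - t) x)) \<le> exp (- \<eta> * (?b - t)) * (1 / \<nu> * V t x)"
      using functional_along_flow[OF t(1,2), of x]
      by (simp add: propagator_to_impulse[OF t(3,4)] impulse_count_to_impulse[OF t(3,4)])
    also have "\<dots> \<le> 1 * (1 / \<nu> * V t x)"
      using \<eta>_pos \<nu>_gt t order_trans[OF norm_ge_zero norm_le_functional[OF t(1)]]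
      by (intro mult_right_mono) auto
    finally show ?case by simp
  qed
  ultimately have "V ?b (J x) \<le> 1 / \<nu> * l"
    by (intro tendsto_le[of "at_left ?b"]) auto
  moreover have "Lim (at_left ?b) (\<lambda>t. V t x) = l" using l by (intro tendsto_Lim) auto
  ultimately show ?thesis by simp
qed

lemma functional_lower_Dini:
  assumes "0 \<le> t"
  shows "lower_Dini S V t x \<le> ereal (- \<eta> * V t x)"
proof -
  obtain k where k: "\<sigma> k \<le> t" "t < \<sigma> (Suc k)" using dwell_interval_exists assms by blast
  have "lower_Dini S V t x \<le> Liminf (at_right 0) (\<lambda>h. ereal ((exp (- \<eta> * h) - 1) / h * V t x))"
    unfolding lower_Dini_def
  proof (rule Liminf_mono, rule eventually_at_rightI)
    fix h assume h: "h \<in> {0<..<\<sigma> (Suc k) - t}"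
    have "V (t + h) (S h x) \<le> exp (- \<eta> * h) * V t x"
      using functional_along_flow[OF assms, of "t + h" x] h k
      by (simp add: propagator_in_dwell[of k] impulse_count_in_dwell[of k])
    hence "(V (t + h) (S h x) - V t x) / h \<le> (exp (- \<eta> * h) * V t x - V t x) / h"
      using h by (intro divide_right_mono) auto
    thus "ereal ((V (t + h) (S h x) - V t x) / h) \<le> ereal ((exp (- \<eta> * h) - 1) / h * V t x)"
      by (simp add: algebra_simps)
  qed (use k in auto)
  also have "\<dots> = ereal (- \<eta> * V t x)"
  proof (intro lim_imp_Liminf tendsto_ereal tendsto_mult tendsto_const)
    have "((\<lambda>h. exp (- \<eta> * h)) has_real_derivative - \<eta>) (at 0)"
      by (auto intro!: derivative_eq_intros)
    thus "((\<lambda>h. (exp (- \<eta> * h) - 1) / h) \<longlongrightarrow> - \<eta>) (at_right 0)"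
      by (simp add: DERIV_def) (rule filterlim_mono[OF _ order_refl at_le], auto)
  qed auto
  finally show ?thesis .
qed

theorem explicit_functional_lyapunov: "lyapunov_functional S J \<sigma> 1 M \<eta> (1 / \<nu>) V"
proof -
  have "lipschitz_on_bounded_unif V"
    unfolding lipschitz_on_bounded_unif_def using functional_lipschitz M_ge
    by (intro allI impI exI[of _ M]) auto
  moreover have "piecewise_right_continuous \<sigma> V"
    unfolding piecewise_right_continuous_def
  proof (intro allI conjI impI)
    fix x k
    show "continuous_on {\<sigma> k..<\<sigma> (Suc k)} (\<lambda>t. V t x)"
      by (intro uniformly_continuous_imp_continuous functional_uniformly_continuous_in_dwell)
  next
    fix x and k :: nat assume "1 \<le> k"
    then obtain j where "k = Suc j" by (cases k) auto
    thus "\<exists>l. ((\<lambda>t. V t x) \<longlongrightarrow> l) (at_left (\<sigma> k))" using functional_left_limit by blast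
  qed
  moreover have "V r (J x) \<le> 1 / \<nu> * Lim (at_left r) (\<lambda>t. V t x)" if r: "r \<in> impulse_times \<sigma>" for r x
  proof -
    obtain n where "n \<ge> 1" "r = \<sigma> n" using r by (auto simp: impulse_times_def)
    then obtain j where "r = \<sigma> (Suc j)" by (cases n) auto
    thus ?thesis using functional_jump by simp
  qed
  moreover have "0 \<le> V t x" if "0 \<le> t" for t x
    using order_trans[OF norm_ge_zero norm_le_functional[OF that]] .
  ultimately show ?thesis
    unfolding lyapunov_functional_def
    using M_ge \<eta>_pos \<nu>_gt norm_le_functional functional_le functional_lower_Dini
    by (intro conjI allI impI ballI) (simp_all only: powr_one norm_ge_zero, auto)
qed

end

section \<open>The equivalence\<close>

theorem theorem5p1:
  fixes D :: "'a::banach set" and A :: "'a \<Rightarrow> 'a"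
    and S :: "real \<Rightarrow> 'a \<Rightarrow>\<^sub>L 'a" and J :: "'a \<Rightarrow>\<^sub>L 'a" and \<sigma> :: "nat \<Rightarrow> real"
  assumes "generates_C0_semigroup D A S"
    and "J \<noteq> 0" and "blinfun_apply J ` D \<subseteq> D"
    and "\<sigma> \<in> impulse_sequences"
    and "growth_condition S J \<sigma>"
  shows "(strongly_GES S J \<sigma> \<longleftrightarrow>
            (\<exists>p c \<eta> \<mu> V. lyapunov_functional S J \<sigma> p c \<eta> \<mu> V)) \<and>
         (\<forall>M \<alpha> \<rho> \<eta> \<nu>.
            GES_estimate S J \<sigma> M \<alpha> \<rho> \<and> 0 < \<eta> \<and> \<eta> < \<alpha> \<and> 1 < \<nu> \<and> \<nu> < 1 / \<rho> \<longrightarrow>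
              (\<forall>t\<ge>0. \<forall>x. bdd_above (explicit_weight S J \<sigma> \<eta> \<nu> t x ` {t..})) \<and>
              lyapunov_functional S J \<sigma> 1 M \<eta> (1 / \<nu>) (explicit_functional S J \<sigma> \<eta> \<nu>))"
proof -
  interpret impulsive_system S J \<sigma>
  proof
    show "C0_semigroup S" using assms(1) unfolding generates_C0_semigroup_def by (elim conjE)
  qed (rule assms(4))
  have explicit: "(\<forall>t\<ge>0. \<forall>x. bdd_above (explicit_weight S J \<sigma> \<eta> \<nu> t x ` {t..})) \<and>
      lyapunov_functional S J \<sigma> 1 M \<eta> (1 / \<nu>) (explicit_functional S J \<sigma> \<eta> \<nu>)"
    if "GES_estimate S J \<sigma> M \<alpha> \<rho>" "0 < \<eta>" "\<eta> < \<alpha>" "1 < \<nu>" "\<nu> < 1 / \<rho>" for M \<alpha> \<rho> \<eta> \<nu>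
  proof -
    interpret ges_impulsive_system S J \<sigma> M \<alpha> \<rho> \<eta> \<nu> using that by unfold_locales
    show ?thesis by (intro conjI allI impI bdd_above_weight explicit_functional_lyapunov)
  qed
  have "\<exists>p c \<eta> \<mu> V. lyapunov_functional S J \<sigma> p c \<eta> \<mu> V" if stable: "strongly_GES S J \<sigma>"
  proof -
    obtain M \<alpha> \<rho> where ges: "GES_estimate S J \<sigma> M \<alpha> \<rho>" using stable by (auto simp: strongly_GES_def)
    hence "0 < \<alpha>" "1 < 1 / \<rho>" by (auto simp: GES_estimate_def)
    then obtain \<eta> \<nu> where "0 < \<eta>" "\<eta> < \<alpha>" "1 < \<nu>" "\<nu> < 1 / \<rho>" by (meson dense)
    from explicit[OF ges this] show ?thesis by (intro exI) (rule conjunct2)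
  qed
  moreover have "strongly_GES S J \<sigma>" if V: "lyapunov_functional S J \<sigma> p c \<eta> \<mu> V" for p c \<eta> \<mu> V
    by (rule growth_condition_dwell_bound[OF assms(5)]) (rule lyapunov_imp_strongly_GES[OF V])
  ultimately have equivalence: "strongly_GES S J \<sigma> \<longleftrightarrow> (\<exists>p c \<eta> \<mu> V. lyapunov_functional S J \<sigma> p c \<eta> \<mu> V)"
    by (intro iffI) (assumption, elim exE, assumption)
  show ?thesis by (rule conjI[OF equivalence], intro allI impI, elim conjE, rule explicit)
qed

end
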